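(* Let $X$ be a Banach space. Given $c>0$, consider the following conditions: $(i_c)$ $\limsup\|x_n\|\le c\cdot\widehat{\operatorname{d}}(\operatorname{clust}_{w^*}(x_n),\{0\})$ for each bounded sequence $(x_n)$ in $X$; $(ii_c)$ $\operatorname{ca}(x_n)\le c\,\delta(x_n)$ for each bounded sequence $(x_n)$ in $X$; $(iii_c)$ $\widetilde{\operatorname{ca}}(x_n)\le c\,\delta(x_n)$ for each bounded sequence $(x_n)$ in $X$; $(iv_c)$ $\widetilde{\operatorname{ca}}(x_n)\le c\,\widetilde\delta(x_n)$ for each bounded sequence $(x_n)$ in $X$; $(v_c)$ $\beta(A)\le c\,\beta_w(A)$ for each bounded set $A\subset X$. Then for each $c>0$ we have $$(i_c)\iff(ii_c)\implies(iii_c)\iff(iv_c)\iff(v_c)\implies(i_{2c+1}).$$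
   Context: $X$ is a real or complex Banach space, canonically embedded in its bidual $X^{**}$. For a bounded sequence $(x_n)$ in $X$, $\operatorname{clust}_{w^*}(x_n)$ is the set of all weak$^*$-cluster points of $(x_n)$ in $X^{**}$, and $\widehat{\operatorname{d}}(A,B)=\sup\{\operatorname{dist}(a,B): a\in A\}$ (so $\widehat{\operatorname{d}}(A,\{0\})=\sup_{a\in A}\|a\|$). For a bounded sequence put $\operatorname{ca}(x_n)=\inf_{n}\operatorname{diam}\{x_k: k\ge n\}$ (also for scalar sequences), $\widetilde{\operatorname{ca}}(x_n)=\inf\{\operatorname{ca}(x_{n_k}): (n_k)\text{ strictly increasing}\}$, $\delta(x_n)=\sup\{\operatorname{ca}(x^*(x_n)): x^*\in B_{X^*}\}$, $\widetilde\delta(x_n)=\inf\{\delta(x_{n_k}): (n_k)\text{ strictly increasing}\}$. For a nonempty bounded set $A\subset X$: $\beta(A)=\sup\{\widetilde{\operatorname{ca}}(x_n): (x_n)\text{ a sequence in }A\}$ and $\beta_w(A)=\sup\{\widetilde\delta(x_n): (x_n)\text{ a sequence in }A\}$. *)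

theory Defs
  imports "HOL-Analysis.Analysis"
begin

text \<open>The scalar fields: up to an isometric isomorphism, exactly the reals and the complex numbers.\<close>

class real_or_complex = real_normed_field +
  assumes real_or_complex:
    "\<exists>\<phi> :: 'a \<Rightarrow> complex.
       (\<forall>a b. \<phi> (a + b) = \<phi> a + \<phi> b) \<and> (\<forall>a b. \<phi> (a * b) = \<phi> a * \<phi> b) \<and>
       (\<forall>r a. \<phi> (r *\<^sub>R a) = r *\<^sub>R \<phi> a) \<and> (\<forall>a. norm (\<phi> a) = norm a) \<and>
       (range \<phi> = \<real> \<or> range \<phi> = UNIV)"

instance real :: real_or_complex
  by standard (rule exI [where x = complex_of_real], auto simp: Reals_def scaleR_conv_of_real)

instance complex :: real_or_complex
  by standard (rule exI [where x = "\<lambda>z. z"], auto)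

text \<open>
  A Banach space over such a field. The class \<open>banach\<close> provides the underlying
  real Banach space (additive structure, complete norm, real scalars), and \<open>smul\<close> is the scalar
  multiplication by the field, which extends the real one.
\<close>

locale banach_over = vector_space smul
  for smul :: "'k::real_or_complex \<Rightarrow> 'a::banach \<Rightarrow> 'a" +
  assumes smul_of_real: "smul (of_real r) x = r *\<^sub>R x"
    and norm_smul: "norm (smul a x) = norm a * norm x"

lemma banach_over_scaleR: "banach_over (scaleR :: real \<Rightarrow> 'a::banach \<Rightarrow> 'a)"
  by unfold_locales (auto simp: algebra_simps)

lemma banach_over_complex: "banach_over ((*) :: complex \<Rightarrow> complex \<Rightarrow> complex)"
  by unfold_locales (auto simp: algebra_simps norm_mult scaleR_conv_of_real)


text \<open>
  The dual space is the subspace of field-linear maps among all bounded real-linear maps into the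
  field; its norm is the operator norm of the type of bounded linear functions.
\<close>

definition dual :: "('k::real_or_complex \<Rightarrow> 'a::banach \<Rightarrow> 'a) \<Rightarrow> ('a \<Rightarrow>\<^sub>L 'k) set" where
  "dual smul = {f. \<forall>a x. blinfun_apply f (smul a x) = a * blinfun_apply f x}"

definition dual_ball :: "('k::real_or_complex \<Rightarrow> 'a::banach \<Rightarrow> 'a) \<Rightarrow> ('a \<Rightarrow>\<^sub>L 'k) set" where
  "dual_ball smul = {f \<in> dual smul. norm f \<le> 1}"

text \<open>
  Elements of the bidual are functions on \<open>dual smul\<close>, made \<open>undefined\<close> elsewhere so that each one
  has a single representative. The functional \<open>blinfun_mult_right a o\<^sub>L f\<close> is the scalar
  multiple of \<open>f\<close> by \<open>a\<close>.
\<close>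

definition bidual :: "('k::real_or_complex \<Rightarrow> 'a::banach \<Rightarrow> 'a) \<Rightarrow> (('a \<Rightarrow>\<^sub>L 'k) \<Rightarrow> 'k) set" where
  "bidual smul = {F \<in> extensional (dual smul).
     (\<forall>f \<in> dual smul. \<forall>g \<in> dual smul. F (f + g) = F f + F g) \<and>
     (\<forall>a. \<forall>f \<in> dual smul. F (blinfun_mult_right a o\<^sub>L f) = a * F f) \<and>
     (\<exists>M. \<forall>f \<in> dual smul. norm (F f) \<le> M * norm f)}"

definition bidual_norm ::
    "('k::real_or_complex \<Rightarrow> 'a::banach \<Rightarrow> 'a) \<Rightarrow> (('a \<Rightarrow>\<^sub>L 'k) \<Rightarrow> 'k) \<Rightarrow> real" where
  "bidual_norm smul F = (SUP f \<in> dual_ball smul. norm (F f))"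

definition bidual_zero ::
    "('k::real_or_complex \<Rightarrow> 'a::banach \<Rightarrow> 'a) \<Rightarrow> ('a \<Rightarrow>\<^sub>L 'k) \<Rightarrow> 'k" where
  "bidual_zero smul = restrict (\<lambda>f. 0) (dual smul)"

definition canonical_embedding ::
    "('k::real_or_complex \<Rightarrow> 'a::banach \<Rightarrow> 'a) \<Rightarrow> 'a \<Rightarrow> ('a \<Rightarrow>\<^sub>L 'k) \<Rightarrow> 'k" where
  "canonical_embedding smul x = restrict (\<lambda>f. blinfun_apply f x) (dual smul)"

definition weak_star ::
    "('k::real_or_complex \<Rightarrow> 'a::banach \<Rightarrow> 'a) \<Rightarrow> (('a \<Rightarrow>\<^sub>L 'k) \<Rightarrow> 'k) topology" where
  "weak_star smul =
     subtopology (product_topology (\<lambda>_. euclidean) (dual smul)) (bidual smul)"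

definition cluster_points :: "'b topology \<Rightarrow> (nat \<Rightarrow> 'b) \<Rightarrow> 'b set" where
  "cluster_points T y =
     {z \<in> topspace T. \<forall>U. openin T U \<and> z \<in> U \<longrightarrow> (\<exists>\<^sub>F n in sequentially. y n \<in> U)}"

definition clust ::
    "('k::real_or_complex \<Rightarrow> 'a::banach \<Rightarrow> 'a) \<Rightarrow> (nat \<Rightarrow> 'a) \<Rightarrow> (('a \<Rightarrow>\<^sub>L 'k) \<Rightarrow> 'k) set" where
  "clust smul x = cluster_points (weak_star smul) (\<lambda>n. canonical_embedding smul (x n))"

definition bidual_dist ::
    "('k::real_or_complex \<Rightarrow> 'a::banach \<Rightarrow> 'a) \<Rightarrow> (('a \<Rightarrow>\<^sub>L 'k) \<Rightarrow> 'k)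
      \<Rightarrow> (('a \<Rightarrow>\<^sub>L 'k) \<Rightarrow> 'k) set \<Rightarrow> real" where
  "bidual_dist smul F B = (INF G \<in> B. bidual_norm smul (restrict (\<lambda>f. F f - G f) (dual smul)))"

definition dhat ::
    "('k::real_or_complex \<Rightarrow> 'a::banach \<Rightarrow> 'a) \<Rightarrow> (('a \<Rightarrow>\<^sub>L 'k) \<Rightarrow> 'k) set
      \<Rightarrow> (('a \<Rightarrow>\<^sub>L 'k) \<Rightarrow> 'k) set \<Rightarrow> real" where
  "dhat smul A B = (SUP F \<in> A. bidual_dist smul F B)"


text \<open>
  All suprema and infima are real-valued; they are meaningful because the quantities below are only
  used for bounded sequences and for nonempty bounded sets.
\<close>

definition ca :: "(nat \<Rightarrow> 'b::metric_space) \<Rightarrow> real" where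
  "ca x = (INF n. diameter (x ` {n..}))"

definition ca_sub :: "(nat \<Rightarrow> 'b::metric_space) \<Rightarrow> real" where
  "ca_sub x = (INF r \<in> {r :: nat \<Rightarrow> nat. strict_mono r}. ca (x \<circ> r))"

definition delta :: "('k::real_or_complex \<Rightarrow> 'a::banach \<Rightarrow> 'a) \<Rightarrow> (nat \<Rightarrow> 'a) \<Rightarrow> real" where
  "delta smul x = (SUP f \<in> dual_ball smul. ca (\<lambda>n. blinfun_apply f (x n)))"

definition delta_sub :: "('k::real_or_complex \<Rightarrow> 'a::banach \<Rightarrow> 'a) \<Rightarrow> (nat \<Rightarrow> 'a) \<Rightarrow> real" where
  "delta_sub smul x = (INF r \<in> {r :: nat \<Rightarrow> nat. strict_mono r}. delta smul (x \<circ> r))"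

definition beta :: "'b::metric_space set \<Rightarrow> real" where
  "beta A = (SUP x \<in> {x :: nat \<Rightarrow> 'b. range x \<subseteq> A}. ca_sub x)"

definition beta_w :: "('k::real_or_complex \<Rightarrow> 'a::banach \<Rightarrow> 'a) \<Rightarrow> 'a set \<Rightarrow> real" where
  "beta_w smul A = (SUP x \<in> {x :: nat \<Rightarrow> 'a. range x \<subseteq> A}. delta_sub smul x)"


definition cond_i :: "('k::real_or_complex \<Rightarrow> 'a::banach \<Rightarrow> 'a) \<Rightarrow> real \<Rightarrow> bool" where
  "cond_i smul c \<longleftrightarrow> (\<forall>x :: nat \<Rightarrow> 'a. bounded (range x) \<longrightarrow>
     limsup (\<lambda>n. ereal (norm (x n))) \<le> ereal (c * dhat smul (clust smul x) {bidual_zero smul}))"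

definition cond_ii :: "('k::real_or_complex \<Rightarrow> 'a::banach \<Rightarrow> 'a) \<Rightarrow> real \<Rightarrow> bool" where
  "cond_ii smul c \<longleftrightarrow> (\<forall>x :: nat \<Rightarrow> 'a. bounded (range x) \<longrightarrow> ca x \<le> c * delta smul x)"

definition cond_iii :: "('k::real_or_complex \<Rightarrow> 'a::banach \<Rightarrow> 'a) \<Rightarrow> real \<Rightarrow> bool" where
  "cond_iii smul c \<longleftrightarrow> (\<forall>x :: nat \<Rightarrow> 'a. bounded (range x) \<longrightarrow> ca_sub x \<le> c * delta smul x)"

definition cond_iv :: "('k::real_or_complex \<Rightarrow> 'a::banach \<Rightarrow> 'a) \<Rightarrow> real \<Rightarrow> bool" where
  "cond_iv smul c \<longleftrightarrow> (\<forall>x :: nat \<Rightarrow> 'a. bounded (range x) \<longrightarrow> ca_sub x \<le> c * delta_sub smul x)"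

definition cond_v :: "('k::real_or_complex \<Rightarrow> 'a::banach \<Rightarrow> 'a) \<Rightarrow> real \<Rightarrow> bool" where
  "cond_v smul c \<longleftrightarrow>
     (\<forall>A :: 'a set. bounded A \<and> A \<noteq> {} \<longrightarrow> beta A \<le> c * beta_w smul A)"

end

theory Submission
  imports Defs
begin

text \<open>
  Write \<open>L(x)\<close> for the supremum, over \<open>f\<close> in the dual ball, of the upper limits of the sequences
  \<open>norm (f (x n))\<close>. By the Banach--Alaoglu theorem (\<open>clust_nonempty\<close>) every subsequence of a
  bounded sequence has a weak-star cluster point, and therefore \<open>L(x)\<close> is the distance on the
  right-hand side of condition (i) (\<open>dhat_clust_le\<close>, \<open>eventually_less_dhat_clust\<close>). From then on
  only \<open>L\<close> is used.

  (i) implies (ii): if the oscillation of \<open>x\<close> exceeds \<open>e\<close>, there are differences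
  \<open>y n = x (k n) - x (l n)\<close> of norm greater than \<open>e\<close> with \<open>k n, l n \<ge> n\<close>, and \<open>L(y)\<close> is at most the
  weak oscillation \<open>\<delta>(x)\<close>. (ii) implies (i): the sequence \<open>x 0, - x 0, x 1, - x 1, \<dots>\<close> has
  oscillation at least twice the upper limit of \<open>norm (x n)\<close> and weak oscillation at most \<open>2 L(x)\<close>.

  The implications from (ii) to (iii), from (iii) to (iv) and from (iv) to (v) follow from monotonicity of the
  quantities under passing to subsequences. (v) implies (iii), which closes the circle: (v) is applied
  to the range of \<open>x\<close>, and every sequence in that range has a subsequence that is either constant
  or a reindexing of \<open>x\<close> by indices tending to infinity (\<open>delta_sub_le_delta_range\<close>).

  (iii) implies (i) with constant \<open>2 c + 1\<close>: the weak oscillation is at most \<open>2 L(x)\<close>, and so some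
  subsequence eventually lies within about \<open>2 c L(x)\<close> of each of its late terms \<open>a\<close>. A functional
  in the dual ball that attains the norm of \<open>a\<close> is at most about \<open>L(x)\<close> in absolute value far out in the sequence,
  which gives \<open>norm a \<le> L(x) + 2 c L(x)\<close> up to a small error. The norming functional is provided by a
  version of the Hahn--Banach theorem, proved through minimal sublinear functionals
  (\<open>linear_below_sublinear\<close>, \<open>norming_functional\<close>).
\<close>

section \<open>The Hahn--Banach theorem for sublinear functionals\<close>

text \<open>Sublinear functionals: subadditive and positively homogeneous; they may take negative values.\<close>

definition sublinear :: "('a::real_vector \<Rightarrow> real) \<Rightarrow> bool" where
  "sublinear q \<longleftrightarrow>
     (\<forall>x y. q (x + y) \<le> q x + q y) \<and> (\<forall>t\<ge>0. \<forall>x. q (t *\<^sub>R x) = t * q x)"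

text \<open>
  The inequality for positive factors suffices: applied to the inverse factor it gives equality, and
  for the factors \<open>1/2\<close> and \<open>2\<close> it gives \<open>q 0 = 0\<close>.
\<close>

lemma sublinearI:
  assumes add: "\<And>x y. q (x + y) \<le> q x + q y"
    and scale: "\<And>t x. t > 0 \<Longrightarrow> q (t *\<^sub>R x) \<le> t * q x"
  shows "sublinear q"
proof -
  have "q (t *\<^sub>R x) = t * q x" if "t \<ge> 0" for t x
  proof (cases "t = 0")
    case True
    have "q 0 \<le> (1/2) * q 0" "q 0 \<le> 2 * q 0"
      using scale[of "1/2" 0] scale[of 2 0] by auto
    then show ?thesis using True by simp
  next
    case False
    with that have t: "t > 0" by simp
    have "q x \<le> inverse t * q (t *\<^sub>R x)"
      using scale[of "inverse t" "t *\<^sub>R x"] t by simp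
    then have "t * q x \<le> q (t *\<^sub>R x)"
      using t by (simp add: field_simps)
    with scale[OF t, of x] show ?thesis by simp
  qed
  with add show ?thesis by (simp add: sublinear_def)
qed

lemma sublinear_add: "sublinear q \<Longrightarrow> q (x + y) \<le> q x + q y"
  by (simp add: sublinear_def)

lemma sublinear_scaleR: "sublinear q \<Longrightarrow> t \<ge> 0 \<Longrightarrow> q (t *\<^sub>R x) = t * q x"
  by (simp add: sublinear_def)

lemma sublinear_0: "sublinear q \<Longrightarrow> q 0 = 0"
  using sublinear_scaleR[of q 0 0] by simp

lemma sublinear_minus: "sublinear q \<Longrightarrow> - q (- x) \<le> q x"
  using sublinear_add[of q x "- x"] sublinear_0[of q] by simp

lemma sublinear_norm: "sublinear norm"
  by (simp add: sublinear_def norm_triangle_ineq)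

text \<open>
  This infimum is taken both over chains, in Zorn's lemma, and over a half-line, in the lemma after it.
  The functions \<open>h i\<close> need not be sublinear one by one.
\<close>

lemma sublinear_INF:
  fixes h :: "'i \<Rightarrow> 'a::real_vector \<Rightarrow> real"
  assumes ne: "I \<noteq> {}"
    and bdd: "\<And>x. bdd_below ((\<lambda>i. h i x) ` I)"
    and add: "\<And>i j x y. i \<in> I \<Longrightarrow> j \<in> I \<Longrightarrow> \<exists>k\<in>I. h k (x + y) \<le> h i x + h j y"
    and scale: "\<And>i s x. i \<in> I \<Longrightarrow> s > 0 \<Longrightarrow> \<exists>k\<in>I. h k (s *\<^sub>R x) \<le> s * h i x"
  shows "sublinear (\<lambda>x. INF i\<in>I. h i x)"
proof (rule sublinearI)
  fix x y
  have le: "(INF k\<in>I. h k (x + y)) \<le> h i x + h j y" if "i \<in> I" "j \<in> I" for i j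
    using add[OF that, of x y] cINF_lower[OF bdd[of "x + y"]] by (meson order_trans)
  have "(INF k\<in>I. h k (x + y)) - (INF j\<in>I. h j y) \<le> h i x" if i: "i \<in> I" for i
  proof -
    have "(INF k\<in>I. h k (x + y)) - h i x \<le> (INF j\<in>I. h j y)"
      using le[OF i] by (intro cINF_greatest ne) (simp add: algebra_simps)
    then show ?thesis by simp
  qed
  then have "(INF k\<in>I. h k (x + y)) - (INF j\<in>I. h j y) \<le> (INF i\<in>I. h i x)"
    by (intro cINF_greatest ne)
  then show "(INF i\<in>I. h i (x + y)) \<le> (INF i\<in>I. h i x) + (INF i\<in>I. h i y)"
    by simp
next
  fix s :: real and x :: 'a assume s: "s > 0"
  have "(INF k\<in>I. h k (s *\<^sub>R x)) / s \<le> h i x" if "i \<in> I" for i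
  proof -
    have "(INF k\<in>I. h k (s *\<^sub>R x)) \<le> s * h i x"
      using scale[OF that s, of x] cINF_lower[OF bdd[of "s *\<^sub>R x"]] by (meson order_trans)
    then show ?thesis using s by (simp add: field_simps)
  qed
  then have "(INF k\<in>I. h k (s *\<^sub>R x)) / s \<le> (INF i\<in>I. h i x)"
    by (intro cINF_greatest ne)
  then show "(INF i\<in>I. h i (s *\<^sub>R x)) \<le> s * (INF i\<in>I. h i x)"
    using s by (simp add: field_simps)
qed

text \<open>
  Every sublinear functional dominates one that is linear on the line through a given vector \<open>y\<close>:
  taking \<open>x = - y\<close> in the last property gives \<open>q' (- y) \<le> - q y\<close>.
\<close>

lemma sublinear_tilt:
  fixes q :: "'a::real_vector \<Rightarrow> real"
  assumes q: "sublinear q"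
  obtains q' where "sublinear q'" "\<And>x. q' x \<le> q x" "\<And>x. q' x \<le> q (x + y) - q y"
proof -
  define h where "h = (\<lambda>t x. q (x + t *\<^sub>R y) - t * q y)"
  define q' where "q' = (\<lambda>x. INF t\<in>{0..}. h t x)"
  have low: "- q (- x) \<le> h t x" if "t \<ge> 0" for t x
    using sublinear_add[OF q, of "x + t *\<^sub>R y" "- x"] sublinear_scaleR[OF q that, of y]
    by (simp add: h_def)
  then have bdd: "bdd_below ((\<lambda>t. h t x) ` {0..})" for x
    by (intro bdd_belowI2[where m = "- q (- x)"]) auto
  have "sublinear q'"
    unfolding q'_def
  proof (rule sublinear_INF[OF _ bdd])
    fix s t :: real and x z :: 'a assume "s \<in> {0..}" "t \<in> {0..}"
    moreover have "h (s + t) (x + z) \<le> h s x + h t z"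
      using sublinear_add[OF q, of "x + s *\<^sub>R y" "z + t *\<^sub>R y"]
      by (simp add: h_def algebra_simps)
    ultimately show "\<exists>k\<in>{0..}. h k (x + z) \<le> h s x + h t z"
      by (intro bexI[where x = "s + t"]) auto
  next
    fix t s :: real and x :: 'a assume "t \<in> {0..}" "s > 0"
    moreover from \<open>s > 0\<close> have "h (s * t) (s *\<^sub>R x) = s * h t x"
      using sublinear_scaleR[OF q, of s "x + t *\<^sub>R y"] by (simp add: h_def algebra_simps)
    ultimately show "\<exists>k\<in>{0..}. h k (s *\<^sub>R x) \<le> s * h t x"
      by (intro bexI[where x = "s * t"]) auto
  qed auto
  moreover have "q' x \<le> q x" for x
    using cINF_lower[OF bdd[of x], of 0] by (simp add: q'_def h_def)
  moreover have "q' x \<le> q (x + y) - q y" for x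
    using cINF_lower[OF bdd[of x], of 1] by (simp add: q'_def h_def)
  ultimately show thesis by (rule that)
qed

text \<open>
  A minimal sublinear functional below \<open>p\<close> exists by Zorn's lemma, and by minimality it is equal to
  each of its tilts, which makes it additive.
\<close>

theorem linear_below_sublinear:
  fixes p :: "'a::real_vector \<Rightarrow> real"
  assumes p: "sublinear p"
  obtains u where "linear u" "\<And>x. u x \<le> p x"
proof -
  define A where "A = {q. sublinear q \<and> q \<le> p}"
  have "\<exists>m\<in>A. \<forall>a\<in>A. a \<le> m \<longrightarrow> a = m"
  proof (rule predicate_Zorn[where P = "\<lambda>q r. r \<le> q"])
    show "partial_order_on A (relation_of (\<lambda>q r. r \<le> q) A)"
      by (rule partial_order_on_relation_ofI) auto
  next
    fix C assume "C \<in> Chains (relation_of (\<lambda>q r. r \<le> q) A)"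
    then have C: "C \<subseteq> A" and chain: "\<And>q r. q \<in> C \<Longrightarrow> r \<in> C \<Longrightarrow> q \<le> r \<or> r \<le> q"
      by (auto simp: Chains_def relation_of_def)
    show "\<exists>u\<in>A. \<forall>a\<in>C. u \<le> a"
    proof (cases "C = {}")
      case True
      then show ?thesis using p by (intro bexI[where x = p]) (auto simp: A_def)
    next
      case False
      have sub: "sublinear q" if "q \<in> C" for q
        using that C by (auto simp: A_def)
      have "- p (- x) \<le> q x" if "q \<in> C" for q x
      proof -
        have "q (- x) \<le> p (- x)" using that C by (auto simp: A_def le_fun_def)
        with sublinear_minus[OF sub[OF that], of x] show ?thesis by simp
      qed
      then have bdd: "bdd_below ((\<lambda>q. q x) ` C)" for x
        by (intro bdd_belowI2[where m = "- p (- x)"])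
      define u where "u = (\<lambda>x. INF q\<in>C. q x)"
      have "sublinear u"
        unfolding u_def
      proof (rule sublinear_INF[OF False bdd])
        fix q r x y assume qr: "q \<in> C" "r \<in> C"
        show "\<exists>k\<in>C. k (x + y) \<le> q x + r y"
        proof (cases "q \<le> r")
          case True
          then have "q (x + y) \<le> q x + r y"
            using sublinear_add[OF sub[OF qr(1)], of x y] le_funD[of q r y] by simp
          with qr show ?thesis by blast
        next
          case False
          then have "r \<le> q" using chain[OF qr] by blast
          then have "r (x + y) \<le> q x + r y"
            using sublinear_add[OF sub[OF qr(2)], of x y] le_funD[of r q x] by simp
          with qr show ?thesis by blast
        qed
      next
        fix q x and s :: real assume "q \<in> C" "s > 0"
        then show "\<exists>k\<in>C. k (s *\<^sub>R x) \<le> s * q x"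
          using sublinear_scaleR[OF sub, of q s x] by (intro bexI[where x = q]) auto
      qed
      moreover have le: "u \<le> q" if "q \<in> C" for q
        using cINF_lower[OF bdd that] by (auto simp: u_def le_fun_def)
      moreover obtain q where "q \<in> C" "q \<le> p"
        using False C unfolding A_def by blast
      ultimately have "u \<in> A" "\<forall>q\<in>C. u \<le> q"
        using order_trans[of u q p] by (auto simp: A_def)
      then show ?thesis by blast
    qed
  qed
  then obtain m where m: "sublinear m" "m \<le> p" and "\<forall>q\<in>A. q \<le> m \<longrightarrow> q = m"
    unfolding A_def by blast
  then have min: "q = m" if "sublinear q" "q \<le> m" for q
    using that order_trans[OF that(2) m(2)] by (simp add: A_def)
  have add: "m (x + y) = m x + m y" for x y
  proof -
    obtain q' where q': "sublinear q'" "\<And>x. q' x \<le> m x" "\<And>x. q' x \<le> m (x + y) - m y"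
      using sublinear_tilt[OF m(1)] by metis
    then have "q' = m" by (intro min) (auto simp: le_fun_def)
    with q'(3)[of x] sublinear_add[OF m(1), of x y] show ?thesis by simp
  qed
  have neg: "m (- x) = - m x" for x
    using add[of x "- x"] sublinear_0[OF m(1)] by simp
  have "linear m"
  proof (rule linearI)
    fix r x show "m (r *\<^sub>R x) = r *\<^sub>R m x"
      using sublinear_scaleR[OF m(1), of r x] sublinear_scaleR[OF m(1), of "- r" x]
        neg[of "r *\<^sub>R x"] by (cases "r \<ge> 0") auto
  qed (rule add)
  with m(2) show thesis by (intro that) (auto simp: le_fun_def)
qed

text \<open>
  Tilting the norm along \<open>x\<close> before passing to a linear functional forces the value \<open>norm x\<close> at \<open>x\<close>.
\<close>

lemma real_norming_functional:
  fixes x :: "'a::real_normed_vector"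
  obtains u :: "'a \<Rightarrow> real" where "linear u" "\<And>y. \<bar>u y\<bar> \<le> norm y" "u x = norm x"
proof -
  obtain q where q: "sublinear q" "\<And>y. q y \<le> norm y" "\<And>y. q y \<le> norm (y + x) - norm x"
    using sublinear_tilt[OF sublinear_norm] by metis
  obtain u where u: "linear u" "\<And>y. u y \<le> q y"
    using linear_below_sublinear[OF q(1)] by metis
  have neg: "u (- y) = - u y" for y
    using u(1) by (rule linear_neg)
  have le: "u y \<le> norm y" for y
    using u(2)[of y] q(2)[of y] by simp
  have "\<bar>u y\<bar> \<le> norm y" for y
    using le[of y] le[of "- y"] neg[of y] by simp
  moreover have "u x = norm x"
    using le[of x] u(2)[of "- x"] q(3)[of "- x"] neg[of x] by simp
  ultimately show thesis using u(1) that by blast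
qed

section \<open>The scalar field\<close>

text \<open>
  The field consists of real multiples of \<open>1\<close>, or it contains an imaginary unit \<open>j\<close> that yields
  isometric real coordinates.
\<close>

lemma real_or_complex_cases:
  obtains (real) "\<And>a::'k::real_or_complex. \<exists>r. a = of_real r"
  | (complex) j :: "'k::real_or_complex" where "j * j = - 1"
      "\<And>a::'k. \<exists>p q. a = of_real p + of_real q * j"
      "\<And>p q. norm (of_real p + of_real q * j) = cmod (Complex p q)"
proof -
  obtain \<phi> :: "'k \<Rightarrow> complex" where add: "\<And>a b. \<phi> (a + b) = \<phi> a + \<phi> b"
    and mult: "\<And>a b. \<phi> (a * b) = \<phi> a * \<phi> b"
    and scale: "\<And>r a. \<phi> (r *\<^sub>R a) = r *\<^sub>R \<phi> a"
    and norm: "\<And>a. norm (\<phi> a) = norm a"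
    and range: "range \<phi> = \<real> \<or> range \<phi> = UNIV"
    using real_or_complex by metis
  have "\<phi> 1 * \<phi> 1 = \<phi> 1" "\<phi> 1 \<noteq> 0"
    using mult[of 1 1] norm[of 1] by auto
  then have "\<phi> 1 = 1" by simp
  then have of_real: "\<phi> (of_real r) = of_real r" for r
    by (metis of_real_def scale)
  have minus: "\<phi> (a - b) = \<phi> a - \<phi> b" for a b
    using add[of "a - b" b] by simp
  have inj: "a = b" if "\<phi> a = \<phi> b" for a b
    using norm[of "a - b"] minus[of a b] that by simp
  from range show thesis
  proof
    assume "range \<phi> = \<real>"
    then have "\<exists>r. a = of_real r" for a :: 'k
      by (metis Reals_cases inj of_real rangeI)
    then show thesis by (rule real)
  next
    assume "range \<phi> = UNIV"
    then obtain j where j: "\<phi> j = \<i>" by (metis surjD)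
    have expand: "\<phi> (of_real p + of_real q * j) = Complex p q" for p q
      by (simp add: add mult of_real j Complex_eq mult.commute)
    show thesis
    proof (rule complex)
      show "j * j = - 1"
        by (rule inj) (use mult[of j j] j minus[of 0 1] minus[of 0 0] \<open>\<phi> 1 = 1\<close> in simp)
      show "\<exists>p q. a = of_real p + of_real q * j" for a :: 'k
        by (metis complex_surj expand inj)
      show "norm (of_real p + of_real q * j) = cmod (Complex p q)" for p q
        using norm expand by metis
    qed
  qed
qed

lemma compact_cball_real_or_complex: "compact (cball (0 :: 'k::real_or_complex) r)"
proof (cases rule: real_or_complex_cases[where 'k = 'k])
  case real
  have "cball (0::'k) r = of_real ` {- r..r}"
  proof (intro equalityI subsetI)
    fix a :: 'k assume a: "a \<in> cball 0 r"
    obtain s where "a = of_real s" using real by blast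
    with a show "a \<in> of_real ` {- r..r}" by (intro image_eqI[where x = s]) auto
  qed auto
  then show ?thesis by (simp add: compact_continuous_image continuous_on_of_real)
next
  case (complex j)
  have "cball (0::'k) r = (\<lambda>z. of_real (Re z) + of_real (Im z) * j) ` cball 0 r"
  proof (intro equalityI subsetI)
    fix a :: 'k assume a: "a \<in> cball 0 r"
    obtain p q where "a = of_real p + of_real q * j" using complex(2) by blast
    with a complex(3) show "a \<in> (\<lambda>z. of_real (Re z) + of_real (Im z) * j) ` cball 0 r"
      by (intro image_eqI[where x = "Complex p q"]) auto
  qed (use complex(3) in auto)
  moreover have "compact ((\<lambda>z. of_real (Re z) + of_real (Im z) * j) ` cball 0 r)"
    by (intro compact_continuous_image continuous_intros compact_cball)
  ultimately show ?thesis by simp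
qed

section \<open>Norming functionals\<close>

context banach_over
begin

text \<open>
  For complex scalars, \<open>f y = u y - i u (i y)\<close> is the complex-linear functional with real
  part \<open>u\<close>; rotating \<open>y\<close> so that \<open>f y\<close> is real and nonnegative shows that \<open>f\<close> has the same norm bound.
\<close>

lemma norming_functional:
  obtains f where "f \<in> dual_ball smul" "norm (blinfun_apply f x) = norm x"
proof -
  obtain u :: "'a \<Rightarrow> real" where lin: "linear u" and le: "\<And>y. \<bar>u y\<bar> \<le> norm y"
    and ux: "u x = norm x"
    using real_norming_functional by blast
  note u = linear_add[OF lin] linear_scale[OF lin] linear_neg[OF lin]
  have "\<exists>f :: 'a \<Rightarrow> 'k. (\<forall>y z. f (y + z) = f y + f z) \<and> (\<forall>a y. f (smul a y) = a * f y) \<and>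
          (\<forall>y. norm (f y) \<le> norm y) \<and> norm (f x) \<ge> norm x"
  proof (cases rule: real_or_complex_cases[where 'k = 'k])
    case real
    have "of_real (u (smul a y)) = a * of_real (u y)" for a y
    proof -
      obtain r where "a = of_real r" using real by blast
      then show ?thesis by (simp add: smul_of_real u)
    qed
    then show ?thesis using le ux by (intro exI[where x = "\<lambda>y. of_real (u y)"]) (auto simp: u)
  next
    case (complex j)
    define f where "f = (\<lambda>y. of_real (u y) - of_real (u (smul j y)) * j :: 'k)"
    have add: "f (y + z) = f y + f z" for y z
      by (simp add: f_def u algebra_simps)
    have jj: "smul j (smul j y) = - y" for y
      using complex(1) by (simp only: scale_scale) simp
    have fj: "f (smul j y) = j * f y" for y
    proof -
      have "f (smul j y) = of_real (u (smul j y)) + of_real (u y) * j"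
        by (simp add: f_def jj u del: scale_scale)
      also have "\<dots> = j * of_real (u y) - of_real (u (smul j y)) * (j * j)"
        using complex(1) by (simp add: mult.commute)
      finally show ?thesis by (simp add: f_def algebra_simps)
    qed
    have fr: "f (smul (of_real r) y) = of_real r * f y" for r y
    proof -
      have "smul j (r *\<^sub>R y) = r *\<^sub>R smul j y"
        by (metis smul_of_real scale_left_commute)
      then show ?thesis by (simp add: f_def smul_of_real u algebra_simps)
    qed
    have scale: "f (smul a y) = a * f y" for a y
    proof -
      obtain p q where a: "a = of_real p + of_real q * j" using complex(2) by blast
      have "smul a y = smul (of_real p) y + smul (of_real q) (smul j y)"
        by (simp add: a scale_left_distrib)
      then show ?thesis by (simp only: add fr fj) (simp add: a algebra_simps)
    qed
    have norm_f: "norm (f y) = cmod (Complex (u y) (- u (smul j y)))" for y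
      using complex(3)[of "u y" "- u (smul j y)"] by (simp add: f_def)
    have "norm (f y) \<le> norm y" for y
    proof (cases "f y = 0")
      case False
      \<comment> \<open>The rotation that makes the value \<open>f y\<close> real and nonnegative.\<close>
      define a where "a = of_real (norm (f y)) / f y"
      have a: "norm a = 1" "f (smul a y) = of_real (norm (f y))"
        using False by (simp_all add: a_def norm_divide scale)
      have "of_real (u (smul a y) - norm (f y)) + of_real (- u (smul j (smul a y))) * j = (0::'k)"
        using a(2) by (simp add: f_def algebra_simps)
      then have "cmod (Complex (u (smul a y) - norm (f y)) (- u (smul j (smul a y)))) = 0"
        using complex(3) by (metis norm_zero)
      then have "u (smul a y) = norm (f y)"
        by (simp add: complex_eq_iff)
      with le[of "smul a y"] a(1) show ?thesis by (simp add: norm_smul)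
    qed auto
    moreover have "norm (f x) \<ge> norm x"
      using norm_f[of x] abs_Re_le_cmod[of "Complex (u x) (- u (smul j x))"] ux by simp
    ultimately show ?thesis using add scale by blast
  qed
  then obtain f :: "'a \<Rightarrow> 'k" where f: "\<And>y z. f (y + z) = f y + f z"
    "\<And>a y. f (smul a y) = a * f y" "\<And>y. norm (f y) \<le> norm y" "norm (f x) \<ge> norm x"
    by blast
  have bl: "bounded_linear f"
    using f(1,3) f(2)[of "of_real _"]
    by (intro bounded_linear_intro[where K = 1]) (auto simp: smul_of_real scaleR_conv_of_real)
  have "norm (Blinfun f) \<le> 1"
    using f(3) by (intro norm_blinfun_bound) (auto simp: bounded_linear_Blinfun_apply[OF bl])
  then have "Blinfun f \<in> dual_ball smul"
    using f(2) by (simp add: dual_ball_def dual_def bounded_linear_Blinfun_apply[OF bl])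
  moreover have "norm (Blinfun f x) = norm x"
    using f(3)[of x] f(4) by (simp add: bounded_linear_Blinfun_apply[OF bl])
  ultimately show thesis by (rule that)
qed

end

section \<open>Oscillation of sequences\<close>

lemma bdd_below_diameter_tails:
  "bounded (range x) \<Longrightarrow> bdd_below (range (\<lambda>n. diameter (x ` {n..})))"
  by (intro bdd_belowI2[where m = 0] diameter_ge_0) (auto elim: bounded_subset)

lemma ca_nonneg: "bounded (range x) \<Longrightarrow> 0 \<le> ca x"
  unfolding ca_def by (intro cINF_greatest diameter_ge_0) (auto elim: bounded_subset)

lemma ca_leI:
  assumes "bounded (range x)"
    and "\<And>e. e > 0 \<Longrightarrow> \<exists>N. \<forall>k\<ge>N. \<forall>l\<ge>N. dist (x k) (x l) \<le> d + e"
  shows "ca x \<le> d"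
proof (rule field_le_epsilon)
  fix e :: real assume "e > 0"
  then obtain N where N: "\<And>k l. k \<ge> N \<Longrightarrow> l \<ge> N \<Longrightarrow> dist (x k) (x l) \<le> d + e"
    using assms(2) by meson
  have "ca x \<le> diameter (x ` {N..})"
    unfolding ca_def using bdd_below_diameter_tails[OF assms(1)] by (rule cINF_lower) simp
  also have "\<dots> \<le> d + e"
    unfolding diameter_def by (auto intro!: cSUP_least N)
  finally show "ca x \<le> d + e" .
qed

lemma ca_lessD:
  assumes "bounded (range x)" and "ca x < d"
  obtains N where "\<And>k l. k \<ge> N \<Longrightarrow> l \<ge> N \<Longrightarrow> dist (x k) (x l) < d"
proof -
  obtain N where "diameter (x ` {N..}) < d"
    using assms(2) cINF_less_iff[OF _ bdd_below_diameter_tails[OF assms(1)]]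
    by (auto simp: ca_def)
  moreover have "dist (x k) (x l) \<le> diameter (x ` {N..})" if "k \<ge> N" "l \<ge> N" for k l
    using that assms(1) by (intro diameter_bounded_bound) (auto elim: bounded_subset)
  ultimately show thesis by (intro that) (auto intro: le_less_trans)
qed

lemma ca_reindex:
  assumes x: "bounded (range x)" and g: "filterlim g at_top sequentially"
  shows "ca (x \<circ> g) \<le> ca x"
proof (rule ca_leI)
  show "bounded (range (x \<circ> g))"
    using x by (rule bounded_subset) auto
  fix e :: real assume "e > 0"
  then obtain N where N: "\<And>k l. k \<ge> N \<Longrightarrow> l \<ge> N \<Longrightarrow> dist (x k) (x l) < ca x + e"
    using ca_lessD[OF x, of "ca x + e"] by auto
  obtain M where "\<And>k. k \<ge> M \<Longrightarrow> g k \<ge> N"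
    using g by (auto simp: filterlim_at_top eventually_sequentially)
  then show "\<exists>M. \<forall>k\<ge>M. \<forall>l\<ge>M. dist ((x \<circ> g) k) ((x \<circ> g) l) \<le> ca x + e"
    using N less_imp_le by (metis comp_apply)
qed

lemma ca_le_diameter:
  assumes "bounded A" and "range x \<subseteq> A"
  shows "ca x \<le> diameter A"
proof (rule ca_leI)
  show "bounded (range x)"
    using assms by (rule bounded_subset)
  fix e :: real assume "e > 0"
  then show "\<exists>N. \<forall>k\<ge>N. \<forall>l\<ge>N. dist (x k) (x l) \<le> diameter A + e"
    using diameter_bounded_bound[OF assms(1)] assms(2)
    by (intro exI allI impI) (meson add_increasing2 less_imp_le rangeI subset_iff)
qed

lemma bounded_range_comp: "bounded (range x) \<Longrightarrow> bounded (range (x \<circ> r))"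
  by (erule bounded_subset) auto

lemma bdd_below_ca_sub:
  "bounded (range x) \<Longrightarrow> bdd_below ((\<lambda>r. ca (x \<circ> r)) ` {r :: nat \<Rightarrow> nat. strict_mono r})"
  by (intro bdd_belowI2[where m = 0] ca_nonneg bounded_range_comp)

lemma ca_sub_le:
  "bounded (range x) \<Longrightarrow> strict_mono r \<Longrightarrow> ca_sub x \<le> ca (x \<circ> r)"
  unfolding ca_sub_def by (intro cINF_lower bdd_below_ca_sub) auto

lemma ca_sub_le_ca: "bounded (range x) \<Longrightarrow> ca_sub x \<le> ca x"
  using ca_sub_le[of x id] by (simp add: strict_mono_def)

lemma ca_sub_lessD:
  assumes "bounded (range x)" and "ca_sub x < d"
  obtains r :: "nat \<Rightarrow> nat" where "strict_mono r" "ca (x \<circ> r) < d"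
proof -
  have "{r :: nat \<Rightarrow> nat. strict_mono r} \<noteq> {}"
    using strict_mono_id by blast
  then show thesis
    using assms(2) cINF_less_iff[OF _ bdd_below_ca_sub[OF assms(1)]] that
    by (auto simp: ca_sub_def)
qed

lemma ca_sub_subseq:
  fixes r :: "nat \<Rightarrow> nat"
  assumes x: "bounded (range x)" and r: "strict_mono r"
  shows "ca_sub x \<le> ca_sub (x \<circ> r)"
  unfolding ca_sub_def[of "x \<circ> r"]
proof (rule cINF_greatest)
  show "{r :: nat \<Rightarrow> nat. strict_mono r} \<noteq> {}"
    using strict_mono_id by blast
  fix s :: "nat \<Rightarrow> nat" assume "s \<in> {r. strict_mono r}"
  then show "ca_sub x \<le> ca (x \<circ> r \<circ> s)"
    using ca_sub_le[OF x, of "r \<circ> s"] r by (simp add: strict_mono_o o_assoc)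
qed

lemma ca_mono:
  assumes "bounded (range x)" "bounded (range y)"
    and le: "\<And>m n. dist (y m) (y n) \<le> dist (x m) (x n)"
  shows "ca y \<le> ca x"
proof (rule ca_leI[OF assms(2)])
  fix e :: real assume "e > 0"
  then obtain N where N: "\<And>k l. k \<ge> N \<Longrightarrow> l \<ge> N \<Longrightarrow> dist (x k) (x l) < ca x + e"
    using ca_lessD[OF assms(1), of "ca x + e"] by auto
  then show "\<exists>N. \<forall>k\<ge>N. \<forall>l\<ge>N. dist (y k) (y l) \<le> ca x + e"
    using le by (meson less_imp_le order_trans)
qed

lemma ca_sub_le_beta:
  assumes A: "bounded A" and x: "range x \<subseteq> A"
  shows "ca_sub x \<le> beta A"
  unfolding beta_def
proof (rule cSUP_upper)
  show "bdd_above (ca_sub ` {x. range x \<subseteq> A})"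
  proof (rule bdd_aboveI2[where M = "diameter A"])
    fix y :: "nat \<Rightarrow> 'a" assume "y \<in> {x. range x \<subseteq> A}"
    then show "ca_sub y \<le> diameter A"
      using ca_sub_le_ca[of y] ca_le_diameter[OF A, of y] bounded_subset[OF A, of "range y"] by simp
  qed
qed (use x in simp)

context banach_over
begin

lemma zero_in_dual_ball: "0 \<in> dual_ball smul"
  by (simp add: dual_ball_def dual_def)

lemma norm_dual_ball_le:
  assumes "f \<in> dual_ball smul"
  shows "norm (blinfun_apply f x) \<le> norm x"
proof -
  have "norm (blinfun_apply f x) \<le> norm f * norm x" by (rule norm_blinfun)
  also have "\<dots> \<le> 1 * norm x"
    using assms by (intro mult_right_mono) (auto simp: dual_ball_def)
  finally show ?thesis by simp
qed

lemma dist_dual_ball_le: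
  "f \<in> dual_ball smul \<Longrightarrow> dist (blinfun_apply f x) (blinfun_apply f y) \<le> dist x y"
  using norm_dual_ball_le[of f "x - y"] by (simp add: dist_norm blinfun.diff_right)

lemma bounded_range_blinfun:
  "bounded (range x) \<Longrightarrow> bounded (range (\<lambda>n. blinfun_apply f (x n)))"
  using bounded_linear_image[OF _ blinfun.bounded_linear_right, of "range x" f]
  by (simp add: image_image)

lemma ca_dual_ball_le:
  "bounded (range x) \<Longrightarrow> f \<in> dual_ball smul \<Longrightarrow> ca (\<lambda>n. blinfun_apply f (x n)) \<le> ca x"
  by (intro ca_mono bounded_range_blinfun dist_dual_ball_le)

lemma delta_leI:
  "(\<And>f. f \<in> dual_ball smul \<Longrightarrow> ca (\<lambda>n. blinfun_apply f (x n)) \<le> d) \<Longrightarrow> delta smul x \<le> d"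
  unfolding delta_def using zero_in_dual_ball by (intro cSUP_least) auto

lemma ca_le_delta:
  assumes "bounded (range x)" and "f \<in> dual_ball smul"
  shows "ca (\<lambda>n. blinfun_apply f (x n)) \<le> delta smul x"
  unfolding delta_def using assms
  by (intro cSUP_upper bdd_aboveI2[where M = "ca x"] ca_dual_ball_le)

lemma delta_nonneg: "bounded (range x) \<Longrightarrow> 0 \<le> delta smul x"
  using ca_le_delta[OF _ zero_in_dual_ball, of x] ca_nonneg[OF bounded_range_blinfun, of x "0 :: 'a \<Rightarrow>\<^sub>L 'k"]
  by simp

lemma delta_le_ca: "bounded (range x) \<Longrightarrow> delta smul x \<le> ca x"
  by (intro delta_leI ca_dual_ball_le)

lemma delta_reindex:
  assumes x: "bounded (range x)" and g: "filterlim g at_top sequentially"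
  shows "delta smul (x \<circ> g) \<le> delta smul x"
proof (rule delta_leI)
  fix f assume f: "f \<in> dual_ball smul"
  have "ca (\<lambda>n. blinfun_apply f ((x \<circ> g) n)) \<le> ca (\<lambda>n. blinfun_apply f (x n))"
    using ca_reindex[OF bounded_range_blinfun[OF x] g] by (simp add: o_def)
  also have "\<dots> \<le> delta smul x" by (rule ca_le_delta[OF x f])
  finally show "ca (\<lambda>n. blinfun_apply f ((x \<circ> g) n)) \<le> delta smul x" .
qed

lemma delta_sub_le:
  assumes "bounded (range x)" and "strict_mono r"
  shows "delta_sub smul x \<le> delta smul (x \<circ> r)"
  unfolding delta_sub_def using assms
  by (intro cINF_lower bdd_belowI2[where m = 0] delta_nonneg bounded_range_comp) auto

lemma delta_sub_le_delta: "bounded (range x) \<Longrightarrow> delta_sub smul x \<le> delta smul x"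
  using delta_sub_le[of x id] by (simp add: strict_mono_def)

lemma delta_sub_le_beta_w:
  assumes A: "bounded A" and x: "range x \<subseteq> A"
  shows "delta_sub smul x \<le> beta_w smul A"
  unfolding beta_w_def
proof (rule cSUP_upper)
  show "bdd_above (delta_sub smul ` {x. range x \<subseteq> A})"
  proof (rule bdd_aboveI2[where M = "diameter A"])
    fix y :: "nat \<Rightarrow> 'a" assume y: "y \<in> {x. range x \<subseteq> A}"
    then have b: "bounded (range y)" using bounded_subset[OF A] by simp
    show "delta_sub smul y \<le> diameter A"
      using delta_sub_le_delta[OF b] delta_le_ca[OF b] ca_le_diameter[OF A, of y] y by simp
  qed
qed (use x in simp)

text \<open>
  A sequence with terms among the \<open>x n\<close> repeats some \<open>x v\<close> infinitely often, or it is a reindexing of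
  \<open>x\<close> by indices that tend to infinity.
\<close>

lemma delta_sub_le_delta_range:
  assumes x: "bounded (range x)" and y: "range y \<subseteq> range x"
  shows "delta_sub smul y \<le> delta smul x"
proof -
  have bdd_y: "bounded (range y)" using x y by (rule bounded_subset)
  have "\<forall>n. \<exists>k. y n = x k" using y by auto
  then obtain i where i: "\<And>n. y n = x (i n)" by metis
  show ?thesis
  proof (cases "\<exists>v. infinite {n. i n = v}")
    case True
    then obtain v where "infinite {n. i n = v}" by blast
    then obtain r :: "nat \<Rightarrow> nat" where r: "strict_mono r" "\<And>n. i (r n) = v"
      using infinite_enumerate by blast
    have const: "y \<circ> r = (\<lambda>n. x v)" by (auto simp: i r(2))
    have "delta_sub smul y \<le> delta smul (y \<circ> r)" by (rule delta_sub_le[OF bdd_y r(1)])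
    also have "\<dots> \<le> ca (y \<circ> r)" by (intro delta_le_ca bounded_range_comp bdd_y)
    also have "\<dots> \<le> 0"
      using bounded_range_comp[OF bdd_y, of r] unfolding const by (intro ca_leI) auto
    also have "0 \<le> delta smul x" by (rule delta_nonneg[OF x])
    finally show ?thesis .
  next
    case False
    have "filterlim i at_top sequentially"
      unfolding filterlim_at_top
    proof
      fix N
      have "{n. \<not> N \<le> i n} = (\<Union>v<N. {n. i n = v})" by auto
      then have "finite {n. \<not> N \<le> i n}" using False by simp
      then show "eventually (\<lambda>n. N \<le> i n) sequentially"
        by (simp add: eventually_cofinite flip: cofinite_eq_sequentially)
    qed
    then have "delta smul (x \<circ> i) \<le> delta smul x" by (rule delta_reindex[OF x])
    moreover have "y = x \<circ> i" using i by auto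
    ultimately show ?thesis using delta_sub_le_delta[OF bdd_y] by simp
  qed
qed

end

section \<open>Weak-star cluster points\<close>

lemma frequently_sequentially_subseq:
  assumes "\<exists>\<^sub>F n in sequentially. P n"
  obtains r :: "nat \<Rightarrow> nat" where "strict_mono r" "\<And>n. P (r n)"
proof -
  have "infinite {n. P n}"
    using assms by (simp add: frequently_cofinite flip: cofinite_eq_sequentially)
  then show thesis using infinite_enumerate that by blast
qed

lemma cluster_points_subseq:
  assumes "strict_mono r"
  shows "cluster_points T (y \<circ> r) \<subseteq> cluster_points T y"
proof -
  have "\<exists>\<^sub>F n in sequentially. P n" if "\<exists>\<^sub>F n in sequentially. P (r n)" for P
    using that eventually_subseq[OF assms, of "\<lambda>n. \<not> P n"] by (auto simp: frequently_def)
  then show ?thesis by (auto simp: cluster_points_def)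
qed

lemma compactin_cluster_point:
  assumes C: "compactin T C" and y: "\<And>n. y n \<in> C"
  shows "C \<inter> cluster_points T y \<noteq> {}"
proof
  assume no: "C \<inter> cluster_points T y = {}"
  define \<U> where "\<U> = {U. openin T U \<and> (\<forall>\<^sub>F n in sequentially. y n \<notin> U)}"
  have "C \<subseteq> topspace T" using C by (rule compactin_subset_topspace)
  have "z \<in> \<Union>\<U>" if "z \<in> C" for z
  proof -
    have "z \<in> topspace T" "z \<notin> cluster_points T y"
      using that no \<open>C \<subseteq> topspace T\<close> by blast+
    then obtain U where "openin T U" "z \<in> U" "\<not> (\<exists>\<^sub>F n in sequentially. y n \<in> U)"
      unfolding cluster_points_def by blast
    then show ?thesis unfolding \<U>_def frequently_def by blast
  qed
  then have "C \<subseteq> \<Union>\<U>" by blast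
  moreover have "\<forall>U\<in>\<U>. openin T U" by (simp add: \<U>_def)
  ultimately obtain \<F> where \<F>: "finite \<F>" "\<F> \<subseteq> \<U>" "C \<subseteq> \<Union>\<F>"
    using C unfolding compactin_def by meson
  have "\<forall>\<^sub>F n in sequentially. \<forall>U\<in>\<F>. y n \<notin> U"
    using \<F>(1,2) by (intro eventually_ball_finite) (auto simp: \<U>_def)
  then obtain n where "\<forall>U\<in>\<F>. y n \<notin> U"
    by (auto simp: eventually_sequentially)
  with y \<F>(3) show False by blast
qed

lemma cluster_points_product_approx:
  fixes y :: "nat \<Rightarrow> 'i \<Rightarrow> 'b::metric_space"
  assumes z: "z \<in> cluster_points (product_topology (\<lambda>_. euclidean) D) y"
    and S: "finite S" "S \<subseteq> D" and e: "e > 0"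
  shows "\<exists>\<^sub>F n in sequentially. \<forall>f\<in>S. dist (y n f) (z f) < e"
proof -
  define U where "U = PiE D (\<lambda>f. if f \<in> S then ball (z f) e else UNIV)"
  have "z \<in> PiE D (\<lambda>_. UNIV)"
    using z by (simp add: cluster_points_def)
  then have "z \<in> U" using e by (auto simp: U_def PiE_iff)
  moreover have "finite {f \<in> D. (if f \<in> S then ball (z f) e else UNIV) \<noteq> UNIV}"
    by (rule finite_subset[OF _ S(1)]) auto
  then have "openin (product_topology (\<lambda>_. euclidean) D) U"
    unfolding U_def openin_PiE_gen by simp
  ultimately have "\<exists>\<^sub>F n in sequentially. y n \<in> U"
    using z unfolding cluster_points_def by blast
  then show ?thesis
  proof (rule frequently_elim1)
    fix n assume "y n \<in> U"
    then show "\<forall>f\<in>S. dist (y n f) (z f) < e"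
      using S(2) by (fastforce simp: U_def PiE_iff dist_commute)
  qed
qed

context banach_over
begin

lemma dual_add: "f \<in> dual smul \<Longrightarrow> g \<in> dual smul \<Longrightarrow> f + g \<in> dual smul"
  by (simp add: dual_def blinfun.add_left algebra_simps)

lemma dual_scale: "f \<in> dual smul \<Longrightarrow> blinfun_mult_right a o\<^sub>L f \<in> dual smul"
  by (simp add: dual_def)

lemma canonical_embedding_in_bidual: "canonical_embedding smul x \<in> bidual smul"
proof -
  have "norm (blinfun_apply f x) \<le> norm x * norm f" for f :: "'a \<Rightarrow>\<^sub>L 'k"
    using norm_blinfun[of f x] by (simp add: mult.commute)
  then show ?thesis
    by (auto simp: bidual_def canonical_embedding_def dual_add dual_scale blinfun.add_left)
qed

text \<open>
  Because the embedded sequence lies in the bidual, its cluster points for the relative topology are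
  those for the product topology that belong to the bidual.
\<close>

lemma clust_eq:
  "clust smul x =
     cluster_points (product_topology (\<lambda>_. euclidean) (dual smul)) (\<lambda>n. canonical_embedding smul (x n))
       \<inter> bidual smul" (is "_ = cluster_points ?T ?y \<inter> _")
proof (intro equalityI subsetI IntI)
  fix F assume F: "F \<in> clust smul x"
  then have top: "F \<in> topspace ?T" "F \<in> bidual smul"
    and freq: "\<And>U. openin (weak_star smul) U \<Longrightarrow> F \<in> U \<Longrightarrow> \<exists>\<^sub>F n in sequentially. ?y n \<in> U"
    unfolding clust_def cluster_points_def weak_star_def by auto
  show "F \<in> bidual smul" by (rule top)
  show "F \<in> cluster_points ?T ?y"
    unfolding cluster_points_def
  proof (intro CollectI conjI allI impI top(1))
    fix V assume V: "openin ?T V \<and> F \<in> V"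
    then have "openin (weak_star smul) (V \<inter> bidual smul)"
      unfolding weak_star_def openin_subtopology by blast
    from freq[OF this] V top(2) show "\<exists>\<^sub>F n in sequentially. ?y n \<in> V"
      by (auto elim: frequently_elim1)
  qed
next
  fix F assume F: "F \<in> cluster_points ?T ?y \<inter> bidual smul"
  then have top: "F \<in> topspace (weak_star smul)"
    and freq: "\<And>V. openin ?T V \<Longrightarrow> F \<in> V \<Longrightarrow> \<exists>\<^sub>F n in sequentially. ?y n \<in> V"
    unfolding cluster_points_def weak_star_def by auto
  show "F \<in> clust smul x"
    unfolding clust_def cluster_points_def
  proof (intro CollectI conjI allI impI top)
    fix U assume "openin (weak_star smul) U \<and> F \<in> U"
    then obtain V where V: "openin ?T V" "U = V \<inter> bidual smul" "F \<in> V"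
      unfolding weak_star_def openin_subtopology by blast
    from freq[OF V(1,3)] show "\<exists>\<^sub>F n in sequentially. ?y n \<in> U"
      by (simp add: V(2) canonical_embedding_in_bidual)
  qed
qed

lemma clust_approx:
  assumes F: "F \<in> clust smul x" and f: "f \<in> dual smul" and e: "e > 0"
    and P: "\<forall>\<^sub>F n in sequentially. P n"
  obtains n where "P n" "dist (blinfun_apply f (x n)) (F f) < e"
proof -
  have "\<exists>\<^sub>F n in sequentially. \<forall>g\<in>{f}. dist (canonical_embedding smul (x n) g) (F g) < e"
    using F f e unfolding clust_eq by (intro cluster_points_product_approx) auto
  then have "\<exists>\<^sub>F n in sequentially. P n \<and> dist (blinfun_apply f (x n)) (F f) < e"
    using frequently_eventually_conj[OF _ P] f by (simp add: canonical_embedding_def)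
  then show thesis using that frequently_ex by blast
qed

lemma clust_subseq: "strict_mono r \<Longrightarrow> clust smul (x \<circ> r) \<subseteq> clust smul x"
  unfolding clust_def
  using cluster_points_subseq[of r _ "\<lambda>n. canonical_embedding smul (x n)"] by (simp add: o_def)

text \<open>
  This is the Banach--Alaoglu theorem: by Tychonoff's theorem the sequence has a cluster point in a
  product of closed balls, and linearity passes to cluster points.
\<close>

lemma clust_nonempty:
  assumes "bounded (range x)"
  shows "clust smul x \<noteq> {}"
proof -
  obtain M where M: "\<And>n. norm (x n) \<le> M"
    using assms by (auto simp: bounded_iff)
  define C where "C = PiE (dual smul) (\<lambda>f. cball (0::'k) (M * norm f))"
  let ?T = "product_topology (\<lambda>_. euclidean) (dual smul)"
  let ?y = "\<lambda>n. canonical_embedding smul (x n)"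
  have "compactin ?T C"
    unfolding C_def compactin_PiE by (simp add: compact_cball_real_or_complex)
  moreover have "?y n \<in> C" for n
  proof -
    have "norm (blinfun_apply f (x n)) \<le> M * norm f" for f :: "'a \<Rightarrow>\<^sub>L 'k"
      using norm_blinfun[of f "x n"] mult_left_mono[OF M[of n], of "norm f"]
      by (simp add: mult.commute)
    then show ?thesis by (auto simp: C_def canonical_embedding_def)
  qed
  ultimately obtain z where zC: "z \<in> C" and z: "z \<in> cluster_points ?T ?y"
    using compactin_cluster_point[of ?T C ?y] by blast
  have approx: "\<exists>n. \<forall>f\<in>S. dist (blinfun_apply f (x n)) (z f) < e"
    if S: "finite S" "S \<subseteq> dual smul" "e > 0" for S e
  proof -
    obtain n where "\<forall>f\<in>S. dist (?y n f) (z f) < e"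
      using cluster_points_product_approx[OF z S, THEN frequently_ex] by blast
    moreover have "?y n f = blinfun_apply f (x n)" if "f \<in> S" for f
      using that S(2) by (auto simp: canonical_embedding_def)
    ultimately show ?thesis by metis
  qed
  have add: "z (f + g) = z f + z g" if f: "f \<in> dual smul" and g: "g \<in> dual smul" for f g
  proof (rule ccontr)
    assume neq: "z (f + g) \<noteq> z f + z g"
    define e where "e = norm (z (f + g) - (z f + z g)) / 3"
    have "e > 0" using neq by (simp add: e_def)
    then obtain n where n: "\<forall>h\<in>{f, g, f + g}. dist (blinfun_apply h (x n)) (z h) < e"
      using approx[of "{f, g, f + g}" e] f g dual_add by auto
    have "z (f + g) - (z f + z g) =
        (blinfun_apply f (x n) - z f) + (blinfun_apply g (x n) - z g)
          - (blinfun_apply (f + g) (x n) - z (f + g))"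
      by (simp add: blinfun.add_left)
    also have "norm \<dots> \<le> norm (blinfun_apply f (x n) - z f) + norm (blinfun_apply g (x n) - z g)
        + norm (blinfun_apply (f + g) (x n) - z (f + g))"
      by (meson add_right_mono norm_triangle_ineq norm_triangle_ineq4 order_trans)
    also have "\<dots> < 3 * e" using n by (simp add: dist_norm)
    finally show False by (simp add: e_def)
  qed
  have scale: "z (blinfun_mult_right a o\<^sub>L f) = a * z f" if f: "f \<in> dual smul" for a f
  proof (rule ccontr)
    let ?h = "blinfun_mult_right a o\<^sub>L f"
    assume neq: "z ?h \<noteq> a * z f"
    define e where "e = norm (z ?h - a * z f) / (1 + norm a)"
    have pos: "1 + norm a > 0" by (simp add: add_pos_nonneg)
    then have e: "e > 0" using neq by (simp add: e_def)
    then obtain n where n: "\<forall>h\<in>{f, ?h}. dist (blinfun_apply h (x n)) (z h) < e"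
      using approx[of "{f, ?h}" e] f dual_scale by auto
    have "z ?h - a * z f = a * (blinfun_apply f (x n) - z f) - (blinfun_apply ?h (x n) - z ?h)"
      by (simp add: algebra_simps)
    also have "norm \<dots> \<le> norm a * norm (blinfun_apply f (x n) - z f)
        + norm (blinfun_apply ?h (x n) - z ?h)"
      by (metis norm_mult norm_triangle_ineq4)
    also have "\<dots> < norm a * e + e"
      using n by (intro add_le_less_mono mult_left_mono) (auto simp: dist_norm)
    also have "\<dots> = (1 + norm a) * e" by (simp add: algebra_simps)
    also have "\<dots> = norm (z ?h - a * z f)" using pos by (simp add: e_def)
    finally show False by simp
  qed
  have "z \<in> bidual smul"
    using zC add scale by (auto simp: bidual_def C_def PiE_iff)
  with z show ?thesis unfolding clust_eq by blast
qed

lemma bidual_norm_upper: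
  assumes F: "F \<in> bidual smul" and f: "f \<in> dual_ball smul"
  shows "norm (F f) \<le> bidual_norm smul F"
  unfolding bidual_norm_def
proof (rule cSUP_upper[OF f])
  obtain M where M: "\<And>f. f \<in> dual smul \<Longrightarrow> norm (F f) \<le> M * norm f"
    using F unfolding bidual_def by blast
  show "bdd_above ((\<lambda>f. norm (F f)) ` dual_ball smul)"
  proof (rule bdd_aboveI2[where M = "\<bar>M\<bar>"])
    fix f assume "f \<in> dual_ball smul"
    then have "norm (F f) \<le> M * norm f" "norm f \<le> 1"
      using M by (auto simp: dual_ball_def)
    moreover have "M * norm f \<le> \<bar>M\<bar> * norm f"
      by (intro mult_right_mono) auto
    moreover have "\<bar>M\<bar> * norm f \<le> \<bar>M\<bar>"
      using calculation(2) by (intro mult_left_le) auto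
    ultimately show "norm (F f) \<le> \<bar>M\<bar>" by linarith
  qed
qed

lemma bidual_norm_leI:
  "(\<And>f. f \<in> dual_ball smul \<Longrightarrow> norm (F f) \<le> d) \<Longrightarrow> bidual_norm smul F \<le> d"
  unfolding bidual_norm_def using zero_in_dual_ball by (intro cSUP_least) auto

lemma bidual_dist_zero:
  assumes "F \<in> bidual smul"
  shows "bidual_dist smul F {bidual_zero smul} = bidual_norm smul F"
proof -
  have "restrict (\<lambda>f. F f - bidual_zero smul f) (dual smul) = F"
    using assms by (intro extensionalityI[where A = "dual smul"])
      (auto simp: bidual_def bidual_zero_def)
  then show ?thesis by (simp add: bidual_dist_def)
qed

lemma dhat_zero_eq:
  "dhat smul (clust smul x) {bidual_zero smul} = (SUP F\<in>clust smul x. bidual_norm smul F)"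
  unfolding dhat_def by (intro SUP_cong refl bidual_dist_zero) (simp add: clust_eq)

lemma norm_clust_le:
  assumes F: "F \<in> clust smul x" and f: "f \<in> dual_ball smul"
    and d: "\<And>e. e > 0 \<Longrightarrow> \<forall>\<^sub>F n in sequentially. norm (blinfun_apply f (x n)) < d + e"
  shows "norm (F f) \<le> d"
proof (rule field_le_epsilon)
  fix e :: real assume e: "e > 0"
  have "f \<in> dual smul" using f by (simp add: dual_ball_def)
  then obtain n where "norm (blinfun_apply f (x n)) < d + e/2"
      "dist (blinfun_apply f (x n)) (F f) < e/2"
    using clust_approx[OF F _ _ d[of "e/2"], of f "e/2"] e by auto
  then show "norm (F f) \<le> d + e"
    using norm_triangle_ineq2[of "F f" "blinfun_apply f (x n)"]
    by (simp add: dist_norm norm_minus_commute)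
qed

text \<open>
  This lemma and the next one identify the quantity on the right-hand side of condition (i) with
  the supremum over \<open>f\<close> in the dual ball of the upper limits of the sequences \<open>norm (f (x n))\<close>.
\<close>

lemma dhat_clust_le:
  assumes x: "bounded (range x)"
    and d: "\<And>f e. f \<in> dual_ball smul \<Longrightarrow> e > 0 \<Longrightarrow>
      \<forall>\<^sub>F n in sequentially. norm (blinfun_apply f (x n)) < d + e"
  shows "dhat smul (clust smul x) {bidual_zero smul} \<le> d"
  unfolding dhat_zero_eq
proof (rule cSUP_least[OF clust_nonempty[OF x]])
  fix F assume F: "F \<in> clust smul x"
  show "bidual_norm smul F \<le> d"
    using norm_clust_le[OF F] d by (blast intro: bidual_norm_leI)
qed

lemma eventually_less_dhat_clust:
  assumes x: "bounded (range x)" and f: "f \<in> dual_ball smul" and e: "e > 0"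
  defines "d \<equiv> dhat smul (clust smul x) {bidual_zero smul}"
  shows "\<forall>\<^sub>F n in sequentially. norm (blinfun_apply f (x n)) < d + e"
proof (rule ccontr)
  assume "\<not> ?thesis"
  then have "\<exists>\<^sub>F n in sequentially. d + e \<le> norm (blinfun_apply f (x n))"
    by (simp add: frequently_def not_le)
  then obtain r :: "nat \<Rightarrow> nat" where r: "strict_mono r"
    and large: "\<And>n. d + e \<le> norm (blinfun_apply f (x (r n)))"
    by (rule frequently_sequentially_subseq) blast
  obtain F where F: "F \<in> clust smul (x \<circ> r)"
    using clust_nonempty[OF bounded_range_comp[OF x]] by blast
  obtain n where "dist (blinfun_apply f ((x \<circ> r) n)) (F f) < e"
    using clust_approx[OF F _ e always_eventually[of "\<lambda>_. True"], of f] f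
    by (auto simp: dual_ball_def)
  then have "d < norm (F f)"
    using large[of n] norm_triangle_ineq2[of "blinfun_apply f (x (r n))" "F f"]
    by (simp add: dist_norm)
  also have "\<dots> \<le> bidual_norm smul F"
    using F f by (intro bidual_norm_upper) (auto simp: clust_eq)
  also have "\<dots> \<le> d"
    unfolding d_def dhat_zero_eq
  proof (rule cSUP_upper)
    show "F \<in> clust smul x" using clust_subseq[OF r] F by blast
    obtain M where M: "\<And>n. norm (x n) \<le> M"
      using x by (auto simp: bounded_iff)
    show "bdd_above (bidual_norm smul ` clust smul x)"
    proof (intro bdd_aboveI2[where M = M] bidual_norm_leI norm_clust_le always_eventually allI)
      fix g n and e :: real assume "g \<in> dual_ball smul" "e > 0"
      then show "norm (blinfun_apply g (x n)) < M + e"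
        using norm_dual_ball_le[of g "x n"] M[of n] by linarith
    qed
  qed
  finally show False by simp
qed

section \<open>The implications\<close>

lemma limsup_le_ereal_iff:
  fixes u :: "nat \<Rightarrow> real"
  shows "limsup (\<lambda>n. ereal (u n)) \<le> ereal d \<longleftrightarrow> (\<forall>e>0. \<forall>\<^sub>F n in sequentially. u n < d + e)"
proof
  assume le: "limsup (\<lambda>n. ereal (u n)) \<le> ereal d"
  show "\<forall>e>0. \<forall>\<^sub>F n in sequentially. u n < d + e"
  proof (intro allI impI)
    fix e :: real assume "e > 0"
    then have "ereal (d + e) > ereal d" by simp
    with le have "limsup (\<lambda>n. ereal (u n)) < ereal (d + e)" by (rule le_less_trans)
    from Limsup_lessD[OF this] show "\<forall>\<^sub>F n in sequentially. u n < d + e" by simp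
  qed
next
  assume *: "\<forall>e>0. \<forall>\<^sub>F n in sequentially. u n < d + e"
  show "limsup (\<lambda>n. ereal (u n)) \<le> ereal d"
  proof (rule ereal_le_epsilon2)
    fix e :: real assume "e > 0"
    with * have "\<forall>\<^sub>F n in sequentially. u n < d + e" by blast
    then have "\<forall>\<^sub>F n in sequentially. ereal (u n) \<le> ereal d + ereal e"
      by (rule eventually_mono) simp
    then show "limsup (\<lambda>n. ereal (u n)) \<le> ereal d + ereal e" by (rule Limsup_bounded)
  qed
qed

text \<open>
  Condition (i) is applied to a sequence of differences \<open>x (k n) - x (l n)\<close> of norm greater than \<open>e\<close>.
\<close>

lemma cond_i_imp_ii:
  assumes c: "c > 0" and i: "cond_i smul c"
  shows "cond_ii smul c"
  unfolding cond_ii_def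
proof (intro allI impI)
  fix x :: "nat \<Rightarrow> 'a" assume x: "bounded (range x)"
  show "ca x \<le> c * delta smul x"
  proof (rule ccontr)
    assume "\<not> ?thesis"
    then obtain e where e: "c * delta smul x < e" "e < ca x"
      using dense not_le by metis
    have "\<exists>k l. k \<ge> N \<and> l \<ge> N \<and> e < dist (x k) (x l)" for N
    proof (rule ccontr)
      assume "\<not> ?thesis"
      then have "ca x \<le> e"
        by (intro ca_leI[OF x] exI[where x = N]) (force simp: not_less)
      with e show False by simp
    qed
    then obtain k l where kl: "\<And>N. k N \<ge> N" "\<And>N. l N \<ge> N" "\<And>N. e < dist (x (k N)) (x (l N))"
      by metis
    define y where "y = (\<lambda>n. x (k n) - x (l n))"
    have y: "bounded (range y)"
      using bounded_minus_comp[OF bounded_range_comp[OF x, of k] bounded_range_comp[OF x, of l]]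
      by (auto simp: y_def bounded_iff)
    have "dhat smul (clust smul y) {bidual_zero smul} \<le> delta smul x"
    proof (rule dhat_clust_le[OF y])
      fix f and e :: real assume f: "f \<in> dual_ball smul" and "e > 0"
      then have "ca (\<lambda>n. blinfun_apply f (x n)) < delta smul x + e"
        using ca_le_delta[OF x f] by simp
      then obtain N where N: "\<And>k l. k \<ge> N \<Longrightarrow> l \<ge> N \<Longrightarrow>
          dist (blinfun_apply f (x k)) (blinfun_apply f (x l)) < delta smul x + e"
        using ca_lessD[OF bounded_range_blinfun[OF x]] by blast
      show "\<forall>\<^sub>F n in sequentially. norm (blinfun_apply f (y n)) < delta smul x + e"
        using eventually_ge_at_top[of N]
      proof eventually_elim
        case (elim n)
        then show ?case
          using N[of "k n" "l n"] kl(1,2)[of n] by (simp add: y_def blinfun.diff_right dist_norm)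
      qed
    qed
    then have "c * dhat smul (clust smul y) {bidual_zero smul} < e"
      using c e(1) by (smt (verit) mult_left_mono)
    moreover have "limsup (\<lambda>n. ereal (norm (y n))) \<le>
        ereal (c * dhat smul (clust smul y) {bidual_zero smul})"
      using i y unfolding cond_i_def by blast
    ultimately have "\<forall>\<^sub>F n in sequentially. norm (y n) < e"
      unfolding limsup_le_ereal_iff by (metis add.commute diff_add_cancel diff_gt_0_iff_gt)
    then obtain n where "norm (y n) < e"
      using eventually_happens' sequentially_bot by blast
    with kl(3)[of n] show False by (simp add: y_def dist_norm)
  qed
qed

lemma dist_le_of_norm_less:
  fixes a b :: "'b::real_normed_vector"
  shows "norm a < d + e/2 \<Longrightarrow> norm b < d + e/2 \<Longrightarrow> dist a b \<le> 2 * d + e"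
  using norm_triangle_ineq4[of a b] by (simp add: dist_norm)

text \<open>
  Condition (ii) is applied to the sequence \<open>x 0, - x 0, x 1, - x 1, \<dots>\<close>, whose oscillation is at
  least twice the upper limit of \<open>norm (x n)\<close>.
\<close>

lemma cond_ii_imp_i:
  assumes c: "c > 0" and ii: "cond_ii smul c"
  shows "cond_i smul c"
  unfolding cond_i_def limsup_le_ereal_iff
proof (intro allI impI)
  fix x :: "nat \<Rightarrow> 'a" and e :: real assume x: "bounded (range x)" and e: "e > 0"
  define d where "d = dhat smul (clust smul x) {bidual_zero smul}"
  define y where "y = (\<lambda>n. if even n then x (n div 2) else - x (n div 2))"
  obtain M where "\<And>n. norm (x n) \<le> M"
    using x by (auto simp: bounded_iff)
  then have "norm (y n) \<le> M" for n
    by (simp add: y_def)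
  then have y: "bounded (range y)"
    unfolding bounded_iff by blast
  have "delta smul y \<le> 2 * d"
  proof (intro delta_leI ca_leI bounded_range_blinfun[OF y])
    fix f and e :: real assume f: "f \<in> dual_ball smul" and "e > 0"
    then have "\<forall>\<^sub>F n in sequentially. norm (blinfun_apply f (x n)) < d + e/2"
      unfolding d_def by (intro eventually_less_dhat_clust x) auto
    then obtain N where N: "\<And>n. n \<ge> N \<Longrightarrow> norm (blinfun_apply f (x n)) < d + e/2"
      by (auto simp: eventually_sequentially)
    have "norm (blinfun_apply f (y n)) < d + e/2" if "n \<ge> 2 * N" for n
      using N[of "n div 2"] that by (auto simp: y_def blinfun.minus_right)
    then show "\<exists>N. \<forall>k\<ge>N. \<forall>l\<ge>N. dist (blinfun_apply f (y k)) (blinfun_apply f (y l)) \<le> 2 * d + e"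
      using dist_le_of_norm_less by meson
  qed
  then have "c * delta smul y \<le> c * (2 * d)" using c by (intro mult_left_mono) auto
  moreover have "ca y \<le> c * delta smul y" using ii y by (simp add: cond_ii_def)
  ultimately have "ca y < 2 * (c * d + e)" using e by simp
  then obtain N where N: "\<And>k l. k \<ge> N \<Longrightarrow> l \<ge> N \<Longrightarrow> dist (y k) (y l) < 2 * (c * d + e)"
    using ca_lessD[OF y] by blast
  have "norm (x n) < c * d + e" if "n \<ge> N" for n
  proof -
    have "dist (y (2 * n)) (y (2 * n + 1)) = norm (2 *\<^sub>R x n)"
      by (simp add: y_def dist_norm scaleR_2)
    with N[of "2 * n" "2 * n + 1"] that show ?thesis by simp
  qed
  then show "\<forall>\<^sub>F n in sequentially. norm (x n) <
      c * dhat smul (clust smul x) {bidual_zero smul} + e"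
    unfolding d_def eventually_sequentially by blast
qed

lemma cond_ii_imp_iii: "cond_ii smul c \<Longrightarrow> cond_iii smul c"
  unfolding cond_ii_def cond_iii_def using ca_sub_le_ca by (meson order_trans)

lemma cond_iii_imp_iv:
  assumes c: "c > 0" and iii: "cond_iii smul c"
  shows "cond_iv smul c"
  unfolding cond_iv_def
proof (intro allI impI)
  fix x :: "nat \<Rightarrow> 'a" assume x: "bounded (range x)"
  have "ca_sub x / c \<le> delta smul (x \<circ> r)" if "strict_mono r" for r
  proof -
    have "ca_sub x \<le> ca_sub (x \<circ> r)" by (rule ca_sub_subseq[OF x that])
    also have "\<dots> \<le> c * delta smul (x \<circ> r)"
      using iii bounded_range_comp[OF x] unfolding cond_iii_def by blast
    finally show ?thesis using c by (simp add: field_simps)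
  qed
  then have "ca_sub x / c \<le> delta_sub smul x"
    unfolding delta_sub_def using strict_mono_id by (intro cINF_greatest) blast+
  then show "ca_sub x \<le> c * delta_sub smul x" using c by (simp add: field_simps)
qed

lemma cond_iv_imp_v:
  assumes c: "c > 0" and iv: "cond_iv smul c"
  shows "cond_v smul c"
  unfolding cond_v_def
proof (intro allI impI)
  fix A :: "'a set" assume A: "bounded A \<and> A \<noteq> {}"
  then obtain a where "a \<in> A" by blast
  then have ne: "{x :: nat \<Rightarrow> 'a. range x \<subseteq> A} \<noteq> {}"
    by (auto intro!: exI[where x = "\<lambda>_. a"])
  show "beta A \<le> c * beta_w smul A"
    unfolding beta_def
  proof (rule cSUP_least[OF ne])
    fix x :: "nat \<Rightarrow> 'a" assume "x \<in> {x. range x \<subseteq> A}"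
    then have x: "range x \<subseteq> A" by simp
    then have "ca_sub x \<le> c * delta_sub smul x"
      using iv A bounded_subset unfolding cond_iv_def by blast
    also have "\<dots> \<le> c * beta_w smul A"
      using c A x by (intro mult_left_mono delta_sub_le_beta_w) auto
    finally show "ca_sub x \<le> c * beta_w smul A" .
  qed
qed

text \<open>
  Condition (v) for the range of \<open>x\<close> bounds \<open>ca_sub x\<close> by a supremum over all sequences in that
  range, none of which contributes more than \<open>delta smul x\<close>.
\<close>

lemma cond_v_imp_iii:
  assumes c: "c > 0" and v: "cond_v smul c"
  shows "cond_iii smul c"
  unfolding cond_iii_def
proof (intro allI impI)
  fix x :: "nat \<Rightarrow> 'a" assume x: "bounded (range x)"
  have "ca_sub x \<le> beta (range x)" by (rule ca_sub_le_beta[OF x]) simp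
  also have "\<dots> \<le> c * beta_w smul (range x)" using v x by (simp add: cond_v_def)
  also have "\<dots> \<le> c * delta smul x"
  proof (rule mult_left_mono)
    show "beta_w smul (range x) \<le> delta smul x"
      unfolding beta_w_def by (rule cSUP_least) (auto intro: delta_sub_le_delta_range[OF x])
  qed (use c in simp)
  finally show "ca_sub x \<le> c * delta smul x" .
qed

text \<open>
  Along a subsequence of terms of large norm, condition (iii) yields terms within \<open>2 c d + e/2\<close> of each
  other; a functional norming one of them is smaller than \<open>d + e/2\<close> at all late terms.
\<close>

lemma cond_iii_imp_i:
  assumes c: "c > 0" and iii: "cond_iii smul c"
  shows "cond_i smul (2 * c + 1)"
  unfolding cond_i_def limsup_le_ereal_iff
proof (intro allI impI)
  fix x :: "nat \<Rightarrow> 'a" and e :: real assume x: "bounded (range x)" and e: "e > 0"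
  define d where "d = dhat smul (clust smul x) {bidual_zero smul}"
  have "\<forall>\<^sub>F n in sequentially. norm (x n) < (2 * c + 1) * d + e"
  proof (rule ccontr)
    \<comment> \<open>Infinitely many terms violate the bound; \<open>r\<close> enumerates their indices.\<close>
    assume "\<not> ?thesis"
    then have "\<exists>\<^sub>F n in sequentially. (2 * c + 1) * d + e \<le> norm (x n)"
      by (simp add: frequently_def not_le)
    then obtain r :: "nat \<Rightarrow> nat" where r: "strict_mono r"
      and large: "\<And>n. (2 * c + 1) * d + e \<le> norm (x (r n))"
      by (rule frequently_sequentially_subseq) blast
    have xr: "bounded (range (x \<circ> r))" by (rule bounded_range_comp[OF x])
    have small: "\<forall>\<^sub>F n in sequentially. norm (blinfun_apply f (x n)) < d + e"
      if "f \<in> dual_ball smul" "e > 0" for f e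
      unfolding d_def using that by (intro eventually_less_dhat_clust x)
    have "delta smul (x \<circ> r) \<le> delta smul x"
      by (rule delta_reindex[OF x filterlim_subseq[OF r]])
    also have "\<dots> \<le> 2 * d"
    proof (intro delta_leI ca_leI bounded_range_blinfun[OF x])
      fix f and e :: real assume f: "f \<in> dual_ball smul" and "e > 0"
      then obtain N where "\<And>n. n \<ge> N \<Longrightarrow> norm (blinfun_apply f (x n)) < d + e/2"
        using small[of f "e/2"] by (auto simp: eventually_sequentially)
      then show "\<exists>N. \<forall>k\<ge>N. \<forall>l\<ge>N. dist (blinfun_apply f (x k)) (blinfun_apply f (x l)) \<le> 2 * d + e"
        using dist_le_of_norm_less by meson
    qed
    finally have "c * delta smul (x \<circ> r) \<le> c * (2 * d)"
      using c by (intro mult_left_mono) auto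
    moreover have "ca_sub (x \<circ> r) \<le> c * delta smul (x \<circ> r)"
      using iii xr by (simp add: cond_iii_def)
    ultimately have "ca_sub (x \<circ> r) < 2 * c * d + e/2" using e by simp
    then obtain s :: "nat \<Rightarrow> nat" where s: "strict_mono s" "ca (x \<circ> r \<circ> s) < 2 * c * d + e/2"
      by (rule ca_sub_lessD[OF xr])
    define t where "t = r \<circ> s"
    have t: "strict_mono t" unfolding t_def using r s(1) by (rule strict_mono_o)
    have "ca (x \<circ> t) < 2 * c * d + e/2" using s(2) by (simp add: t_def o_assoc)
    then obtain N where N: "\<And>k l. k \<ge> N \<Longrightarrow> l \<ge> N \<Longrightarrow> dist (x (t k)) (x (t l)) < 2 * c * d + e/2"
      using ca_lessD[OF bounded_range_comp[OF x, of t]] by auto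
    obtain f where f: "f \<in> dual_ball smul" "norm (blinfun_apply f (x (t N))) = norm (x (t N))"
      by (rule norming_functional)
    have "\<forall>\<^sub>F n in sequentially. norm (blinfun_apply f (x (t n))) < d + e/2"
      using small[OF f(1), of "e/2"] e by (intro eventually_subseq[OF t]) auto
    then obtain n where n: "n \<ge> N" "norm (blinfun_apply f (x (t n))) < d + e/2"
      by (auto simp: eventually_sequentially) (meson nat_le_linear)
    have "norm (x (t N)) \<le> norm (blinfun_apply f (x (t n)))
        + dist (blinfun_apply f (x (t N))) (blinfun_apply f (x (t n)))"
      using norm_triangle_sub[of "blinfun_apply f (x (t N))" "blinfun_apply f (x (t n))"] f(2)
      by (simp add: dist_norm)
    also have "\<dots> < (d + e/2) + (2 * c * d + e/2)"
      using n N[of N n] dist_dual_ball_le[OF f(1), of "x (t N)" "x (t n)"] by linarith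
    also have "\<dots> \<le> norm (x (t N))"
      using large[of "s N"] by (simp add: t_def algebra_simps)
    finally show False by simp
  qed
  then show "\<forall>\<^sub>F n in sequentially. norm (x n) <
      (2 * c + 1) * dhat smul (clust smul x) {bidual_zero smul} + e"
    by (simp add: d_def)
qed

end

theorem proposition5p1:
  fixes smul :: "'k::real_or_complex \<Rightarrow> 'a::banach \<Rightarrow> 'a" and c :: real
  assumes "banach_over smul" and "c > 0"
  shows "(cond_i smul c \<longleftrightarrow> cond_ii smul c) \<and>
         (cond_ii smul c \<longrightarrow> cond_iii smul c) \<and>
         (cond_iii smul c \<longleftrightarrow> cond_iv smul c) \<and>
         (cond_iv smul c \<longleftrightarrow> cond_v smul c) \<and>
         (cond_v smul c \<longrightarrow> cond_i smul (2 * c + 1))"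
proof -
  interpret banach_over smul by fact
  from \<open>c > 0\<close> show ?thesis
    using cond_i_imp_ii cond_ii_imp_i cond_ii_imp_iii cond_iii_imp_iv cond_iv_imp_v
      cond_v_imp_iii cond_iii_imp_i by blast
qed

end
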